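(* Let $G$ be a commutative semigroup (written additively) with a finite system of generators $S$. A probability distribution $\mu=\{\mu(s);\,s\in S\}$ on $S$ is precentral if and only if for every pair of vectors $(m_s)_{s\in S}$ and $(n_s)_{s\in S}$ from $\mathbb{N}_0^S$ such that $$\sum_{s\in S} m_s=\sum_{s\in S} n_s \ \text{ in } \mathbb{N}_0 \qquad\text{and}\qquad \sum_{s\in S} m_s\cdot s=\sum_{s\in S} n_s\cdot s\ \text{ in } G,$$ the following equation holds: $$\prod_{s\in S}(\mu(s))^{m_s}=\prod_{s\in S}(\mu(s))^{n_s}.$$
   Context: Here $\mathbb{N}_0=\{0,1,2,\dots\}$ and $0^0=1$. A finite system of generators $S$ of a commutative semigroup $G$ is a finite nonempty family of elements of $G$, repetitions allowed (repeated elements being treated as distinct members of $S$), generating $G$ (if $G$ has an identity element, the identity need not be a sum of a nonempty sequence of members of $S$). Let $G^1=G$ if $G$ has an identity element, and otherwise let $G^1$ be $G$ with an identity element adjoined; denote the identity by $0$ (the empty sum is $0$). The Cayley graph of $(G,S)$ has vertex set $G^1$ and, for every vertex $g$ and every $s\in S$, a directed edge marked by $s$ from $g$ to $g+s$; the distinguished vertex is $0$. The space $\mathscr{P}$ of infinite paths starting at $0$ is identified, via sequences of edge marks, with $S^{\mathbb{N}}$ with the product topology. The measure of a finite path starting at $0$ is the measure of the cylinder of all infinite paths beginning with it. A Borel probability measure $\nu$ on $\mathscr{P}$ is central if for every vertex $v$ and every positive integer $n$, $\nu$ takes the same value on all paths of length $n$ leading from $0$ to $v$. A probability distribution $\mu$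 on $S$ is called precentral if the corresponding measure with i.i.d. increments, i.e. the Borel probability measure on $\mathscr{P}$ whose value on each finite path with successive edge marks $s_1,\dots,s_n$ is $\mu(s_1)\cdots\mu(s_n)$, is central. *)

theory Defs
  imports "HOL-Probability.Probability"
begin

text \<open>
  The semigroup \<open>G\<close> is a type of class \<^class>\<open>ab_semigroup_add\<close>.  Its monoid \<open>G\<^sup>1\<close> is
  the type \<open>'a unital\<close> below: the value \<^const>\<open>None\<close> (an adjoined identity) is present
  exactly if \<open>G\<close> has no identity of its own.
\<close>

definition is_identity :: "'a::ab_semigroup_add \<Rightarrow> bool" where
  "is_identity e \<longleftrightarrow> (\<forall>a. e + a = a)"

lemma is_identity_unique: "is_identity e \<Longrightarrow> is_identity e' \<Longrightarrow> e = e'"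
  unfolding is_identity_def by (metis add.commute)

typedef (overloaded) ('a::ab_semigroup_add) unital =
  "{x :: 'a option. x = None \<longrightarrow> (\<nexists>e::'a. is_identity e)}"
  by (rule exI[of _ "Some undefined"]) simp

setup_lifting type_definition_unital

lift_definition to_unital :: "'a::ab_semigroup_add \<Rightarrow> 'a unital" is Some
  by simp

instantiation unital :: (ab_semigroup_add) comm_monoid_add
begin

lift_definition zero_unital :: "'a unital" is
  "if (\<exists>e::'a. is_identity e) then Some (THE e. is_identity e) else None"
  by (auto split: if_splits)

lift_definition plus_unital :: "'a unital \<Rightarrow> 'a unital \<Rightarrow> 'a unital" is
  "\<lambda>x y. case x of None \<Rightarrow> y
       | Some a \<Rightarrow> (case y of None \<Rightarrow> Some a | Some b \<Rightarrow> Some (a + b))"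
  by (auto split: option.splits)

instance
proof
  fix a b c :: "'a unital"
  show "a + b + c = a + (b + c)"
    by transfer (auto split: option.splits simp: add.assoc)
  show "a + b = b + a"
    by transfer (auto split: option.splits simp: add.commute)
  show "0 + a = a"
  proof (cases "\<exists>e::'a. is_identity e")
    case True
    then obtain e :: 'a where e: "is_identity e" by blast
    then have the: "(THE e::'a. is_identity e) = e"
      using is_identity_unique by blast
    from e have "e + x = x" for x by (simp add: is_identity_def)
    then show ?thesis
      using True the by transfer (auto split: option.splits)
  next
    case False
    then show ?thesis by transfer auto
  qed
qed

end

lemma to_unital_inject [simp]: "to_unital a = to_unital b \<longleftrightarrow> a = b"
  by transfer simp

lemma to_unital_add: "to_unital (a + b) = to_unital a + to_unital b"
  by transfer simp

lemma to_unital_eq_0_iff: "to_unital a = 0 \<longleftrightarrow> is_identity a"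
proof -
  have the: "(THE e. is_identity e) = e" if "is_identity e" for e :: 'a
    using that is_identity_unique by blast
  show ?thesis
    by transfer (metis option.distinct(1) option.inject the)
qed

lemma unital_cases: "x = 0 \<or> (\<exists>a. x = to_unital a)"
  by transfer (metis not_None_eq)

definition multiple :: "nat \<Rightarrow> 'b::comm_monoid_add \<Rightarrow> 'b" where
  "multiple k x = (\<Sum>i<k. x)"

text \<open>
  A system of generators is a family \<open>gen\<close> indexed by a finite type \<open>'s\<close>, whose elements
  serve as the (distinct) members of \<open>S\<close>.  The sum is formed in \<open>G\<^sup>1\<close>, so the empty sum
  accounts for an identity element of \<open>G\<close> and for nothing else.
\<close>

definition generating_system :: "('s::finite \<Rightarrow> 'a::ab_semigroup_add) \<Rightarrow> bool" where
  "generating_system gen \<longleftrightarrow> (\<forall>g::'a. \<exists>w::'s list. to_unital g = (\<Sum>s\<leftarrow>w. to_unital (gen s)))"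

definition cayley_edge ::
  "('s \<Rightarrow> 'a::ab_semigroup_add) \<Rightarrow> 'a unital \<Rightarrow> 's \<Rightarrow> 'a unital \<Rightarrow> bool" where
  "cayley_edge gen g s h \<longleftrightarrow> h = g + to_unital (gen s)"

text \<open>Paths are identified with their sequences of edge marks.\<close>

fun leads ::
  "('s \<Rightarrow> 'a::ab_semigroup_add) \<Rightarrow> 'a unital \<Rightarrow> 's list \<Rightarrow> 'a unital \<Rightarrow> bool" where
  "leads gen g [] h \<longleftrightarrow> g = h"
| "leads gen g (s # w) h \<longleftrightarrow> (\<exists>k. cayley_edge gen g s k \<and> leads gen k w h)"

definition cylinder :: "'s list \<Rightarrow> (nat \<Rightarrow> 's) set" where
  "cylinder w = {x. \<forall>i<length w. x i = w ! i}"

definition path_borel :: "(nat \<Rightarrow> 's) measure" where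
  "path_borel = sigma UNIV
     {U. openin (product_topology (\<lambda>_::nat. discrete_topology (UNIV :: 's set)) UNIV) U}"

definition central ::
  "('s \<Rightarrow> 'a::ab_semigroup_add) \<Rightarrow> (nat \<Rightarrow> 's) measure \<Rightarrow> bool" where
  "central gen \<nu> \<longleftrightarrow> prob_space \<nu> \<and> sets \<nu> = sets path_borel \<and>
     (\<forall>v n. n > 0 \<longrightarrow>
        (\<forall>p q. length p = n \<and> leads gen 0 p v \<and> length q = n \<and> leads gen 0 q v \<longrightarrow>
           measure \<nu> (cylinder p) = measure \<nu> (cylinder q)))"

definition iid_measure :: "'s pmf \<Rightarrow> (nat \<Rightarrow> 's) measure" where
  "iid_measure \<mu> = (\<Pi>\<^sub>M i\<in>(UNIV::nat set). measure_pmf \<mu>)"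

definition precentral :: "('s \<Rightarrow> 'a::ab_semigroup_add) \<Rightarrow> 's pmf \<Rightarrow> bool" where
  "precentral gen \<mu> \<longleftrightarrow> central gen (iid_measure \<mu>)"

text \<open>
  For finite \<open>'s\<close>, \<^const>\<open>iid_measure\<close> is the unique Borel probability measure on the path
  space that gives each cylinder the product of the probabilities of its edge marks.
\<close>

lemma openin_cylinder:
  "openin (product_topology (\<lambda>_::nat. discrete_topology (UNIV :: 's set)) UNIV) (cylinder w)"
proof -
  have "cylinder w = (\<Pi>\<^sub>E i\<in>UNIV. if i < length w then {w ! i} else UNIV)"
    by (auto simp: cylinder_def PiE_iff) (metis singletonD)
  also have "openin (product_topology (\<lambda>_::nat. discrete_topology (UNIV :: 's set)) UNIV) \<dots>"
    by (rule product_topology_basis) (auto intro: finite_subset[of _ "{..<length w}"])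
  finally show ?thesis .
qed

lemma cylinder_measurable:
  "cylinder w \<in> sets (\<Pi>\<^sub>M i\<in>(UNIV::nat set). count_space (UNIV :: 's set))"
proof -
  have "cylinder w = {x \<in> space (\<Pi>\<^sub>M i\<in>(UNIV::nat set). count_space (UNIV :: 's set)).
      \<forall>i\<in>{..<length w}. x i = w ! i}"
    by (auto simp: cylinder_def space_PiM)
  also have "\<dots> \<in> sets (\<Pi>\<^sub>M i\<in>(UNIV::nat set). count_space (UNIV :: 's set))"
    by measurable
  finally show ?thesis .
qed

lemma open_eq_Union_cylinders:
  assumes "openin (product_topology (\<lambda>_::nat. discrete_topology (UNIV :: 's set)) UNIV) U"
  shows "U = (\<Union>w\<in>{w. cylinder w \<subseteq> U}. cylinder w)"
proof (rule set_eqI, rule iffI)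
  fix x assume "x \<in> U"
  then have "\<exists>X. x \<in> (\<Pi>\<^sub>E i\<in>UNIV. X i) \<and>
      (\<forall>i. openin (discrete_topology UNIV) (X i)) \<and>
      finite {i. X i \<noteq> topspace (discrete_topology (UNIV :: 's set))} \<and>
      (\<Pi>\<^sub>E i\<in>UNIV. X i) \<subseteq> U"
    by (rule product_topology_open_contains_basis[OF assms])
  then obtain X where X: "x \<in> (\<Pi>\<^sub>E i\<in>UNIV. X i)" "finite {i. X i \<noteq> (UNIV :: 's set)}"
      "(\<Pi>\<^sub>E i\<in>UNIV. X i) \<subseteq> U"
    by auto
  obtain n where n: "{i. X i \<noteq> UNIV} \<subseteq> {..<n}"
    using finite_nat_iff_bounded X(2) by blast
  have "y \<in> U" if y: "y \<in> cylinder (map x [0..<n])" for y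
  proof -
    have "y i \<in> X i" for i
      using y n X(1) by (cases "i < n") (auto simp: cylinder_def PiE_iff)
    then show ?thesis using X(3) by (auto simp: PiE_iff)
  qed
  then show "x \<in> (\<Union>w\<in>{w. cylinder w \<subseteq> U}. cylinder w)"
    by (intro UN_I[of "map x [0..<n]"]) (auto simp: cylinder_def)
qed auto

lemma sets_path_borel:
  "sets path_borel = sets (\<Pi>\<^sub>M i\<in>(UNIV::nat set). count_space (UNIV :: 's::finite set))"
    (is "_ = sets ?P")
proof
  let ?T = "product_topology (\<lambda>_::nat. discrete_topology (UNIV :: 's set)) UNIV"
  have "{U. openin ?T U} \<subseteq> sets ?P"
  proof clarify
    fix U assume "openin ?T U"
    then have "U = (\<Union>w\<in>{w. cylinder w \<subseteq> U}. cylinder w)"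
      by (rule open_eq_Union_cylinders)
    also have "\<dots> \<in> sets ?P"
      by (intro sets.countable_UN'') (auto intro: cylinder_measurable)
    finally show "U \<in> sets ?P" .
  qed
  then have "sigma_sets UNIV {U. openin ?T U} \<subseteq> sets ?P"
    using sets.sigma_sets_subset[of _ ?P] by (simp add: space_PiM PiE_def)
  then show "sets path_borel \<subseteq> sets ?P"
    by (simp add: path_borel_def)
  show "sets ?P \<subseteq> sets path_borel"
  proof (rule sets_PiM_in_sets)
    show "space (path_borel :: (nat \<Rightarrow> 's) measure) = (\<Pi>\<^sub>E i\<in>UNIV. space (count_space UNIV))"
      by (simp add: path_borel_def space_measure_of_conv)
  next
    fix i :: nat and A :: "'s set"
    have "{x. x i \<in> A} = (\<Pi>\<^sub>E j\<in>UNIV. if j = i then A else UNIV)"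
      by (auto simp: PiE_iff split: if_splits)
    also have "openin ?T \<dots>"
      by (rule product_topology_basis) (auto intro: finite_subset[of _ "{i}"])
    finally show "{x \<in> space path_borel. x i \<in> A} \<in> sets path_borel"
      by (auto simp: path_borel_def space_measure_of_conv)
  qed
qed

lemma prob_space_iid_measure: "prob_space (iid_measure \<mu>)"
  unfolding iid_measure_def by (intro prob_space_PiM measure_pmf.prob_space_axioms)

lemma sets_iid_measure: "sets (iid_measure (\<mu> :: 's::finite pmf)) = sets path_borel"
  unfolding iid_measure_def sets_path_borel by (intro sets_PiM_cong) auto

lemma measure_iid_cylinder: "measure (iid_measure \<mu>) (cylinder w) = (\<Prod>s\<leftarrow>w. pmf \<mu> s)"
proof -
  interpret product_prob_space "\<lambda>_::nat. measure_pmf \<mu>" UNIV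
    by unfold_locales
  have "cylinder w = {x \<in> space (\<Pi>\<^sub>M i\<in>UNIV. measure_pmf \<mu>). \<forall>i\<in>{..<length w}. x i \<in> {w ! i}}"
    by (auto simp: cylinder_def space_PiM)
  then have "emeasure (iid_measure \<mu>) (cylinder w) = (\<Prod>i<length w. emeasure (measure_pmf \<mu>) {w ! i})"
    unfolding iid_measure_def by (simp only:) (rule emeasure_PiM_Collect, auto)
  then have "measure (iid_measure \<mu>) (cylinder w) = (\<Prod>i<length w. pmf \<mu> (w ! i))"
    by (simp add: measure_def emeasure_pmf_single prod_ennreal prod_nonneg)
  also have "\<dots> = (\<Prod>s\<leftarrow>w. pmf \<mu> s)"
    by (induction w) (simp_all add: prod.lessThan_Suc_shift del: prod.lessThan_Suc)
  finally show ?thesis .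
qed

lemma iid_measure_unique:
  fixes \<mu> :: "'s::finite pmf"
  assumes "prob_space \<nu>" "sets \<nu> = sets path_borel"
    and cyl: "\<And>w. measure \<nu> (cylinder w) = (\<Prod>s\<leftarrow>w. pmf \<mu> s)"
  shows "\<nu> = iid_measure \<mu>"
proof -
  interpret N: prob_space \<nu> by fact
  interpret M: prob_space "iid_measure \<mu>" by (rule prob_space_iid_measure)
  let ?E = "insert {} (range (cylinder :: 's list \<Rightarrow> _))"
  let ?P = "\<Pi>\<^sub>M i\<in>(UNIV::nat set). count_space (UNIV :: 's set)"
  have inter: "cylinder v \<inter> cylinder w \<in> ?E" if "length v \<le> length w" for v w :: "'s list"
  proof (cases "\<forall>i<length v. v ! i = w ! i")
    case True
    then have "cylinder v \<inter> cylinder w = cylinder w"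
      using that by (auto simp: cylinder_def)
    then show ?thesis by simp
  next
    case False
    then have "cylinder v \<inter> cylinder w = {}"
      using that by (fastforce simp: cylinder_def)
    then show ?thesis by simp
  qed
  have inter': "cylinder v \<inter> cylinder w \<in> ?E" for v w :: "'s list"
    using inter[of v w] inter[of w v] by (cases "length v \<le> length w") (auto simp: Int_commute)
  have stable: "Int_stable ?E"
    using inter' by (fastforce simp: Int_stable_def)
  have gen: "sets path_borel = sigma_sets UNIV ?E"
  proof
    have "{U. openin (product_topology (\<lambda>_::nat. discrete_topology (UNIV :: 's set)) UNIV) U}
        \<subseteq> sigma_sets UNIV ?E"
    proof clarify
      fix U assume "openin (product_topology (\<lambda>_::nat. discrete_topology (UNIV :: 's set)) UNIV) U"
      then have "U = (\<Union>w\<in>{w. cylinder w \<subseteq> U}. cylinder w)"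
        by (rule open_eq_Union_cylinders)
      also have "\<dots> \<in> sigma_sets UNIV ?E"
        by (rule sigma_sets_UNION) (auto intro: sigma_sets.Basic)
      finally show "U \<in> sigma_sets UNIV ?E" .
    qed
    then show "sets path_borel \<subseteq> sigma_sets UNIV ?E"
      by (simp add: path_borel_def sigma_sets_mono)
    show "sigma_sets UNIV ?E \<subseteq> sets path_borel"
      unfolding path_borel_def by (auto intro!: sigma_sets_mono sigma_sets.Basic openin_cylinder)
  qed
  show ?thesis
  proof (rule measure_eqI_generator_eq[where E = ?E and \<Omega> = UNIV and A = "\<lambda>_. cylinder []"])
    show "Int_stable ?E" by (rule stable)
    show "sets \<nu> = sigma_sets UNIV ?E" "sets (iid_measure \<mu>) = sigma_sets UNIV ?E"
      using assms(2) gen by (simp_all add: sets_iid_measure)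
    show "emeasure \<nu> X = emeasure (iid_measure \<mu>) X" if "X \<in> ?E" for X
      using that by (auto simp: N.emeasure_eq_measure M.emeasure_eq_measure cyl measure_iid_cylinder)
    show "emeasure \<nu> (cylinder []) \<noteq> \<infinity>" by simp
  qed (use rangeI[of cylinder "[]"] in \<open>auto simp: cylinder_def\<close>)
qed

end

theory Submission
  imports Defs
begin

text \<open>
  Since addition commutes, the endpoint, the length and the i.i.d. measure of a path depend only
  on how often each edge mark occurs in it, and every multiplicity vector comes from some path.
\<close>

lemma leads_iff: "leads gen g w h \<longleftrightarrow> h = g + (\<Sum>s\<leftarrow>w. to_unital (gen s))"
  by (induction w arbitrary: g) (auto simp: cayley_edge_def add.assoc)

lemma multiple_0 [simp]: "multiple 0 x = 0"
  by (simp add: multiple_def)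

lemma multiple_Suc [simp]: "multiple (Suc k) x = x + multiple k x"
  by (simp add: multiple_def add.commute)

lemma sum_list_map_eq_sum_multiple_count_list:
  fixes f :: "'s::finite \<Rightarrow> 'b::comm_monoid_add"
  shows "(\<Sum>s\<leftarrow>w. f s) = (\<Sum>s\<in>UNIV. multiple (count_list w s) (f s))"
proof (induction w)
  case (Cons a w)
  \<comment> \<open>The head matters only at the index \<open>a\<close>. Written as an indicator
    summand, it splits off by \<open>sum.distrib\<close>, and its sum over all marks collapses to
    \<open>f a\<close>.\<close>
  have "multiple (count_list (a # w) s) (f s)
      = (if s = a then f s else 0) + multiple (count_list w s) (f s)" for s
    by simp
  then show ?case
    by (simp only: sum.distrib) (simp add: Cons)
qed simp

lemma prod_list_map_eq_prod_power_count_list: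
  fixes f :: "'s::finite \<Rightarrow> 'b::comm_monoid_mult"
  shows "(\<Prod>s\<leftarrow>w. f s) = (\<Prod>s\<in>UNIV. f s ^ count_list w s)"
proof (induction w)
  case (Cons a w)
  \<comment> \<open>The multiplicative analogue: the head is a factor that equals 1 away from
    \<open>a\<close>.\<close>
  have "f s ^ count_list (a # w) s = (if s = a then f s else 1) * f s ^ count_list w s" for s
    by simp
  then show ?case
    by (simp only: prod.distrib) (simp add: Cons)
qed simp

lemma length_eq_sum_count_list: "length w = (\<Sum>s\<in>UNIV. count_list w (s :: 's::finite))"
  by (rule sum_count_set [symmetric]) simp_all

text \<open>Over a finite type every vector has finite support and so is a multiset; any enumeration
  of that multiset serves as \<open>w\<close>.\<close>

lemma ex_count_list:
  fixes m :: "'s::finite \<Rightarrow> nat"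
  shows "\<exists>w. count_list w = m"
proof -
  obtain w where "mset w = Abs_multiset m"
    using ex_mset by blast
  then have "count (mset w) = m"
    by (simp add: Abs_multiset_inverse)
  then show ?thesis
    by (auto simp: count_mset fun_eq_iff)
qed

text \<open>An i.i.d. measure is always a Borel probability measure, so only the comparison of
  cylinders remains; there the common endpoint and length become equations between the two
  words.\<close>

lemma precentral_iff_paths:
  fixes gen :: "'s::finite \<Rightarrow> 'a::ab_semigroup_add" and \<mu> :: "'s pmf"
  shows "precentral gen \<mu> \<longleftrightarrow>
    (\<forall>p q. length p = length q \<and> (\<Sum>s\<leftarrow>p. to_unital (gen s)) = (\<Sum>s\<leftarrow>q. to_unital (gen s)) \<longrightarrow>
       (\<Prod>s\<leftarrow>p. pmf \<mu> s) = (\<Prod>s\<leftarrow>q. pmf \<mu> s))"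
proof -
  \<comment> \<open>Allowing length 0 adds no condition, because the empty word is the only one of
    that length and \<open>P\<close> is compared with itself.\<close>
  have eliminate_endpoint: "(\<forall>v n. n > 0 \<longrightarrow>
        (\<forall>p q. length p = n \<and> v = f p \<and> length q = n \<and> v = f q \<longrightarrow> P p = P q))
      \<longleftrightarrow> (\<forall>p q. length p = length q \<and> f p = f q \<longrightarrow> P p = P q)"
    for f :: "'s list \<Rightarrow> 'a unital" and P :: "'s list \<Rightarrow> real"
    by (metis length_greater_0_conv length_0_conv)
  show ?thesis
    unfolding precentral_def central_def leads_iff measure_iid_cylinder add_0_left
    by (simp only: prob_space_iid_measure sets_iid_measure simp_thms)
      (rule eliminate_endpoint)
qed

theorem theorem2:
  fixes gen :: "'s::finite \<Rightarrow> 'a::ab_semigroup_add" and \<mu> :: "'s pmf"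
  assumes "generating_system gen"
  shows "precentral gen \<mu> \<longleftrightarrow>
    (\<forall>m n :: 's \<Rightarrow> nat.
       (\<Sum>s\<in>UNIV. m s) = (\<Sum>s\<in>UNIV. n s) \<and>
       (\<Sum>s\<in>UNIV. multiple (m s) (to_unital (gen s))) = (\<Sum>s\<in>UNIV. multiple (n s) (to_unital (gen s))) \<longrightarrow>
       (\<Prod>s\<in>UNIV. pmf \<mu> s ^ m s) = (\<Prod>s\<in>UNIV. pmf \<mu> s ^ n s))"
proof -
  \<comment> \<open>Surjectivity of \<open>count_list\<close> lets the vectors range over
    multiplicities of words. Once lengths, sums and products are also expressed by multiplicities,
    both sides of the theorem coincide literally.\<close>
  have all_vectors: "(\<forall>m n. P m n) \<longleftrightarrow> (\<forall>p q. P (count_list p) (count_list q))"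
    for P :: "('s \<Rightarrow> nat) \<Rightarrow> ('s \<Rightarrow> nat) \<Rightarrow> bool"
    by (metis ex_count_list)
  show ?thesis
    unfolding precentral_iff_paths length_eq_sum_count_list all_vectors
      sum_list_map_eq_sum_multiple_count_list prod_list_map_eq_prod_power_count_list ..
qed

end
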